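(* Suppose there exist locally Lipschitz functions $f,g$ and an additive disturbance $w_t$ such that the states $x_t\in\mathbb{R}^d$ and actions $u_t\in\mathbb{R}^m$ satisfy $x_{t+1}=f(x_t)+g(x_t)u_t+w_t$ with $\|w_t\|\le\bar w$ almost surely. For each barrier function $h_i:\mathbb{R}^d\to\mathbb{R}$ suppose there is $L_i>0$ with $|h_i(x)-h_i(y)|\le L_i\|x-y\|$ for all $x,y$. Assume that at time $t$ the applied action satisfies, for each $i$, $$h_i\big(f(x_t)+g(x_t)u_t\big)-(1-\kappa_i\Delta t)\,h_i(x_t)\ \ge\ \varepsilon_i,\qquad \kappa_i>0,$$ with margin $\varepsilon_i\ge L_i\bar w$. Then, if $h_i(x_t)\ge 0$ for all $i$, we have $h_i(x_{t+1})\ge 0$ for all $i$. Hence the safe set $\mathcal{C}:=\{x:\ h_i(x)\ge 0\ \text{for all } i\}$ is forward invariant.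
   Context: $\|\cdot\|$ is the Euclidean norm. Time $t=0,1,2,\dots$ is discrete and $\Delta t$ is the time-step size. $f$ takes values in $\mathbb{R}^d$ and $g$ in $\mathbb{R}^{d\times m}$. The displayed inequality is a discrete-time control barrier function condition with margin, enforced at each time step by a quadratic-program safety layer that selects $u_t$; $\kappa_i$ are its gains. Forward invariance of $\mathcal{C}$ means that states starting in $\mathcal{C}$ remain in $\mathcal{C}$ at all later times.
   Formalization: The gains are additionally required to satisfy κ_iΔt ≤ 1; without this the claim is false (d=1, h(x)=x, f(x)=−x, g=0, w=0, ε=0, κΔt=2 sends 1 to −1). *)

theory Defs
  imports "HOL-Probability.Probability"
begin

text \<open>The first argument of \<^const>\<open>local_lipschitz\<close> is a set of times, on which \<open>F\<close> does not depend.\<close>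

definition locally_lipschitz :: "('a::metric_space \<Rightarrow> 'b::metric_space) \<Rightarrow> bool" where
  "locally_lipschitz F \<longleftrightarrow> local_lipschitz (UNIV :: real set) UNIV (\<lambda>_. F)"

text \<open>
  A discrete-time barrier condition keeps \<open>h\<close> nonnegative only if its decay rate \<open>\<kappa> * \<Delta>t\<close> is at most 1:
  with \<open>h x = x\<close>, \<open>f x = -x\<close>, \<open>g = 0\<close>, \<open>\<kappa> * \<Delta>t = 2\<close>, \<open>\<epsilon> = 0\<close> on the real line it holds everywhere, but 1 is
  mapped to -1. The bound is not part of the definition and has to be assumed separately.
\<close>

definition dcbf_condition ::
  "(real^'d \<Rightarrow> real^'d) \<Rightarrow> (real^'d \<Rightarrow> real^'m^'d) \<Rightarrow> real \<Rightarrow> (real^'d \<Rightarrow> real) \<Rightarrow> real \<Rightarrow> real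
    \<Rightarrow> real^'d \<Rightarrow> real^'m \<Rightarrow> bool" where
  "dcbf_condition f g \<Delta>t h \<kappa> \<epsilon> x u \<longleftrightarrow>
     h (f x + g x *v u) - (1 - \<kappa> * \<Delta>t) * h x \<ge> \<epsilon>"

definition safe_set :: "'i set \<Rightarrow> ('i \<Rightarrow> 'a \<Rightarrow> real) \<Rightarrow> 'a set" where
  "safe_set I h = {x. \<forall>i\<in>I. h i x \<ge> 0}"

text \<open>
  Almost every path of the state process \<open>X\<close> that is in \<open>C\<close> at some time \<open>s\<close> (in particular
  at time 0) stays in \<open>C\<close> from then on. The exceptional null set does not depend on \<open>s\<close> or \<open>t\<close>.
\<close>

definition forward_invariant :: "'w measure \<Rightarrow> (nat \<Rightarrow> 'w \<Rightarrow> 'a) \<Rightarrow> 'a set \<Rightarrow> bool" where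
  "forward_invariant M X C \<longleftrightarrow>
     (AE \<omega> in M. \<forall>s. X s \<omega> \<in> C \<longrightarrow> (\<forall>t\<ge>s. X t \<omega> \<in> C))"

end

theory Submission
  imports Defs
begin

text \<open>Let \<open>y\<close> be the state that the dynamics would reach without disturbance. The
  barrier condition gives \<open>h y\<close> at least the margin \<open>\<epsilon>\<close> plus a
  nonnegative fraction of the current value of \<open>h\<close>, because
  \<open>\<kappa> * \<Delta>t \<le> 1\<close>. By the Lipschitz bound a disturbance of norm at most
  \<open>w_bar\<close> costs at most \<open>L * w_bar\<close>, which the margin covers.
  \<open>dcbf_condition_step\<close> is this estimate at a single sample point;
  \<open>forward_invariantI\<close> turns almost sure one-step preservation into invariance along
  whole paths.\<close>

lemma dcbf_condition_step:
  assumes "dcbf_condition f g \<Delta>t h \<kappa> \<epsilon> x u"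
    and lip: "\<And>y z. \<bar>h y - h z\<bar> \<le> L * norm (y - z)"
    and "L \<ge> 0" and "norm w \<le> w_bar" and "\<epsilon> \<ge> L * w_bar"
    and "\<kappa> * \<Delta>t \<le> 1" and "h x \<ge> 0"
  shows "h (f x + g x *v u + w) \<ge> 0"
proof -
  let ?y = "f x + g x *v u"
  \<comment> \<open>The chain bounds the loss caused by \<open>w\<close> by \<open>h ?y\<close>
    itself; cancelling \<open>h ?y\<close> then leaves the claim.\<close>
  have "h ?y - h (?y + w) \<le> L * norm w"
    using lip[of ?y "?y + w"] by simp
  also have "\<dots> \<le> \<epsilon>"
    using mult_left_mono[OF \<open>norm w \<le> w_bar\<close> \<open>L \<ge> 0\<close>] \<open>\<epsilon> \<ge> L * w_bar\<close> by linarith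
  also have "\<epsilon> \<le> h ?y - (1 - \<kappa> * \<Delta>t) * h x"
    using assms(1) by (simp add: dcbf_condition_def)
  \<comment> \<open>The subtracted term is a product of two nonnegative factors; this is where the
    bound on the decay rate enters.\<close>
  also have "\<dots> \<le> h ?y"
    using \<open>\<kappa> * \<Delta>t \<le> 1\<close> \<open>h x \<ge> 0\<close> by simp
  finally show ?thesis
    by simp
qed

text \<open>Time is countable, so the null sets of the single steps unite to one null set. Outside
  it, induction on \<open>t\<close> starting at \<open>s\<close> carries membership in
  \<open>C\<close> along the path.\<close>

lemma forward_invariantI:
  assumes "\<And>t. AE \<omega> in M. X t \<omega> \<in> C \<longrightarrow> X (Suc t) \<omega> \<in> C"
  shows "forward_invariant M X C"
proof -
  have "AE \<omega> in M. \<forall>t. X t \<omega> \<in> C \<longrightarrow> X (Suc t) \<omega> \<in> C"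
    using assms by (simp add: AE_all_countable)
  then show ?thesis
    unfolding forward_invariant_def
  proof (eventually_elim, intro allI impI)
    fix \<omega> s t
    assume step: "\<forall>t. X t \<omega> \<in> C \<longrightarrow> X (Suc t) \<omega> \<in> C" and "X s \<omega> \<in> C" and "s \<le> t"
    from \<open>s \<le> t\<close> show "X t \<omega> \<in> C"
      by (induction rule: dec_induct) (use step \<open>X s \<omega> \<in> C\<close> in auto)
  qed
qed

theorem theorem1:
  fixes M :: "'w measure"
    and f :: "real^'d \<Rightarrow> real^'d"
    and g :: "real^'d \<Rightarrow> real^'m^'d"
    and x :: "nat \<Rightarrow> 'w \<Rightarrow> real^'d"
    and u :: "nat \<Rightarrow> 'w \<Rightarrow> real^'m"
    and w :: "nat \<Rightarrow> 'w \<Rightarrow> real^'d"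
    and w_bar \<Delta>t :: real
    and I :: "'i set"
    and h :: "'i \<Rightarrow> real^'d \<Rightarrow> real"
    and L \<kappa> \<epsilon> :: "'i \<Rightarrow> real"
  assumes "prob_space M"
    and "\<And>t. x t \<in> borel_measurable M"
    and "\<And>t. u t \<in> borel_measurable M"
    and "\<And>t. w t \<in> borel_measurable M"
    and "locally_lipschitz f"
    and "locally_lipschitz g"
    and "\<And>t. AE \<omega> in M. x (Suc t) \<omega> = f (x t \<omega>) + g (x t \<omega>) *v u t \<omega> + w t \<omega>"
    and "\<And>t. AE \<omega> in M. norm (w t \<omega>) \<le> w_bar"
    and "\<And>i. i \<in> I \<Longrightarrow> L i > 0"
    and "\<And>i y z. i \<in> I \<Longrightarrow> \<bar>h i y - h i z\<bar> \<le> L i * norm (y - z)"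
    and "\<Delta>t > 0"
    and "\<And>i. i \<in> I \<Longrightarrow> \<kappa> i > 0"
    and "\<And>i. i \<in> I \<Longrightarrow> \<kappa> i * \<Delta>t \<le> 1"
    and "\<And>i. i \<in> I \<Longrightarrow> \<epsilon> i \<ge> L i * w_bar"
  shows
    "(\<forall>t. (AE \<omega> in M. \<forall>i\<in>I. dcbf_condition f g \<Delta>t (h i) (\<kappa> i) (\<epsilon> i) (x t \<omega>) (u t \<omega>)) \<longrightarrow>
          (AE \<omega> in M. (\<forall>i\<in>I. h i (x t \<omega>) \<ge> 0) \<longrightarrow> (\<forall>i\<in>I. h i (x (Suc t) \<omega>) \<ge> 0))) \<and>
     ((\<forall>t. AE \<omega> in M. \<forall>i\<in>I. dcbf_condition f g \<Delta>t (h i) (\<kappa> i) (\<epsilon> i) (x t \<omega>) (u t \<omega>)) \<longrightarrow>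
          forward_invariant M x (safe_set I h))"
proof -
  have step: "AE \<omega> in M. (\<forall>i\<in>I. h i (x t \<omega>) \<ge> 0) \<longrightarrow> (\<forall>i\<in>I. h i (x (Suc t) \<omega>) \<ge> 0)"
    if "AE \<omega> in M. \<forall>i\<in>I. dcbf_condition f g \<Delta>t (h i) (\<kappa> i) (\<epsilon> i) (x t \<omega>) (u t \<omega>)" for t
    \<comment> \<open>Three almost sure facts at the fixed time \<open>t\<close> are intersected.
      The index \<open>i\<close> is chosen only after the sample point, so no countability of
      \<open>I\<close> is required.\<close>
    using that assms(7)[of t] assms(8)[of t]
  proof (eventually_elim, intro impI ballI)
    fix \<omega> i
    assume "\<forall>i\<in>I. dcbf_condition f g \<Delta>t (h i) (\<kappa> i) (\<epsilon> i) (x t \<omega>) (u t \<omega>)"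
      and next_state: "x (Suc t) \<omega> = f (x t \<omega>) + g (x t \<omega>) *v u t \<omega> + w t \<omega>"
      and "norm (w t \<omega>) \<le> w_bar" and "\<forall>i\<in>I. h i (x t \<omega>) \<ge> 0" and "i \<in> I"
    then have dcbf: "dcbf_condition f g \<Delta>t (h i) (\<kappa> i) (\<epsilon> i) (x t \<omega>) (u t \<omega>)" and nonneg: "h i (x t \<omega>) \<ge> 0"
      by auto
    show "h i (x (Suc t) \<omega>) \<ge> 0"
      unfolding next_state
      by (rule dcbf_condition_step[OF dcbf assms(10)[OF \<open>i \<in> I\<close>] less_imp_le[OF assms(9)[OF \<open>i \<in> I\<close>]]
          \<open>norm (w t \<omega>) \<le> w_bar\<close> assms(14)[OF \<open>i \<in> I\<close>] assms(13)[OF \<open>i \<in> I\<close>] nonneg])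
  qed
  have "forward_invariant M x (safe_set I h)"
    if "\<forall>t. AE \<omega> in M. \<forall>i\<in>I. dcbf_condition f g \<Delta>t (h i) (\<kappa> i) (\<epsilon> i) (x t \<omega>) (u t \<omega>)"
    \<comment> \<open>Membership in \<open>safe_set I h\<close> unfolds to the nonnegativity of all
      barriers, which is what \<open>step\<close> propagates.\<close>
    by (rule forward_invariantI) (use step that in \<open>simp add: safe_set_def\<close>)
  with step show ?thesis
    by blast
qed

end
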